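(* Let $A$ be either a field or an integral domain that is an integral extension of $\mathbb{Z}$. Then any integral domain $R$ that is essentially of finite type over $A$ is locally Egyptian.
   Context: An element of the fraction field of an integral domain $D$ is called Egyptian (with respect to $D$) if it can be written as a finite sum $\frac{1}{d_1}+\cdots+\frac{1}{d_n}$ with $d_1,\ldots,d_n$ distinct nonzero elements of $D$. An integral domain $D$ is called Egyptian if every nonzero element of $D$ is Egyptian. An integral domain $D$ is locally Egyptian if there is a finite system $f_1,\ldots,f_n$ of (nonzero) generators of the unit ideal of $D$ such that $D[1/f_j]$ is Egyptian for all $1\le j\le n$. A ring $S$ is essentially of finite type over a ring $B$ if it is a localization (at a multiplicative set) of a finitely generated $B$-algebra. The structure map $A \to R$ is not assumed injective. All rings are commutative with identity. *)

theory Defs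
  imports
    "HOL-Computational_Algebra.Fraction_Field"
    "Subresultants.More_Homomorphisms"
begin

section \<open>Egyptian and locally Egyptian domains\<close>

definition subring_of :: "'b::comm_ring_1 set \<Rightarrow> bool" where
  "subring_of D \<longleftrightarrow> 1 \<in> D \<and> (\<forall>x\<in>D. \<forall>y\<in>D. x - y \<in> D \<and> x * y \<in> D)"

text \<open>A domain \<open>D\<close> is represented as a subring of a field \<open>'k\<close>, so that its fraction field
  lies inside \<open>'k\<close>. A finite set \<open>S\<close> of denominators encodes that they are distinct.\<close>

definition egyptian_element :: "'k::field set \<Rightarrow> 'k \<Rightarrow> bool" where
  "egyptian_element D x \<longleftrightarrow>
     (\<exists>S. finite S \<and> S \<noteq> {} \<and> S \<subseteq> D - {0} \<and> x = (\<Sum>d\<in>S. 1 / d))"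

definition egyptian :: "'k::field set \<Rightarrow> bool" where
  "egyptian D \<longleftrightarrow> subring_of D \<and> (\<forall>x\<in>D - {0}. egyptian_element D x)"

text \<open>The ring \<open>R[1/f]\<close>, for \<open>f \<noteq> 0\<close>, inside the fraction field of \<open>R\<close>.\<close>

definition localization_away :: "'r::idom \<Rightarrow> 'r fract set" where
  "localization_away f = {Fract a (f ^ n) | a n. True}"

text \<open>The span of \<open>F\<close> in the ring regarded as a module over itself is the ideal generated
  by \<open>F\<close>.\<close>

definition locally_egyptian :: "'r::idom itself \<Rightarrow> bool" where
  "locally_egyptian _ \<longleftrightarrow>
     (\<exists>F :: 'r set. finite F \<and> 0 \<notin> F \<and> module.span (*) F = UNIV \<and>
        (\<forall>f\<in>F. egyptian (localization_away f)))"

section \<open>Algebras essentially of finite type\<close>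

definition finitely_generated_algebra :: "('a::comm_ring_1 \<Rightarrow> 'b::comm_ring_1) \<Rightarrow> bool" where
  "finitely_generated_algebra \<alpha> \<longleftrightarrow>
     comm_ring_hom \<alpha> \<and> (\<exists>G. finite G \<and> subring_of hull (range \<alpha> \<union> G) = UNIV)"

definition multiplicative_set :: "'b::comm_ring_1 set \<Rightarrow> bool" where
  "multiplicative_set M \<longleftrightarrow> 1 \<in> M \<and> (\<forall>x\<in>M. \<forall>y\<in>M. x * y \<in> M)"

text \<open>The homomorphism \<open>\<iota>\<close> exhibits its codomain as \<open>M\<^sup>-\<^sup>1B\<close>, where \<open>B\<close> is its domain:
  \<open>(b, m) \<mapsto> \<iota> b / \<iota> m\<close> is defined, onto, and identifies fractions exactly as in \<open>M\<^sup>-\<^sup>1B\<close>.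
  The set \<open>M\<close> may contain zero divisors.\<close>

definition is_localization :: "'b::comm_ring_1 set \<Rightarrow> ('b \<Rightarrow> 'r::comm_ring_1) \<Rightarrow> bool" where
  "is_localization M \<iota> \<longleftrightarrow>
     comm_ring_hom \<iota> \<and> multiplicative_set M \<and>
     (\<forall>m\<in>M. \<iota> m dvd 1) \<and>
     (\<forall>r. \<exists>b. \<exists>m\<in>M. r * \<iota> m = \<iota> b) \<and>
     (\<forall>b c. \<forall>m\<in>M. \<forall>n\<in>M. \<iota> b * \<iota> n = \<iota> c * \<iota> m \<longleftrightarrow> (\<exists>t\<in>M. t * (b * n) = t * (c * m)))"

text \<open>The homomorphism \<open>\<phi>\<close> is the structure map. HOL cannot quantify existentially over
  types, so the type \<open>'b\<close> of the finitely generated algebra that is localized is a parameter;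
  as a free type variable in an assumption it ranges over all commutative rings.\<close>

definition essentially_finite_type ::
    "'b::comm_ring_1 itself \<Rightarrow> ('a::comm_ring_1 \<Rightarrow> 'r::comm_ring_1) \<Rightarrow> bool" where
  "essentially_finite_type _ \<phi> \<longleftrightarrow>
     (\<exists>(\<alpha> :: 'a \<Rightarrow> 'b) M \<iota>.
        finitely_generated_algebra \<alpha> \<and> is_localization M \<iota> \<and> \<phi> = \<iota> \<circ> \<alpha>)"

section \<open>The base ring\<close>

definition is_field :: "'a::idom itself \<Rightarrow> bool" where
  "is_field _ \<longleftrightarrow> (\<forall>x::'a. x \<noteq> 0 \<longrightarrow> (\<exists>y. x * y = 1))"

text \<open>The library predicate \<open>algebraic_int\<close> is restricted to elements of fields. The
  injectivity condition says that \<open>\<int>\<close> is a subring, i.e.\ that the characteristic is \<open>0\<close>.\<close>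

definition integral_extension_of_int :: "'a::idom itself \<Rightarrow> bool" where
  "integral_extension_of_int _ \<longleftrightarrow>
     inj (of_int :: int \<Rightarrow> 'a) \<and>
     (\<forall>x::'a. \<exists>p :: int poly. lead_coeff p = 1 \<and> poly (map_poly of_int p) x = 0)"

end

theory Submission
  imports Defs
begin

text \<open>For a domain \<open>D\<close> in a field, the finite sums of reciprocals \<open>1 / d\<close> with repetitions allowed
  form a \<^emph>\<open>subring\<close> \<open>E\<close> of the field (\<open>subring_of_unit_fraction_sums\<close>): products of reciprocals
  are reciprocals, and so are their negatives. Repetitions can always be removed
  (\<open>egyptian_element_if_unit_fraction_sum\<close>), so that \<open>D\<close> is Egyptian as soon as \<open>D \<subseteq> E\<close>. Since
  \<open>E\<close> is a ring, it suffices to place a set of generators of \<open>D\<close> in \<open>E\<close>.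

  Three kinds of elements \<open>x\<close> lie in \<open>E\<close>: reciprocals of elements of \<open>D\<close>, hence also the units of
  \<open>D\<close>; elements \<open>1 - u\<close> with \<open>u\<close> a unit of \<open>D\<close>; and elements of \<open>D\<close> integral over \<open>\<int>\<close>, because an
  integral equation divided by a power of \<open>x\<close> writes \<open>x\<close> as a polynomial in \<open>1 / x\<close> with integer
  coefficients (\<open>integral_in_unit_fraction_sums\<close>).

  Let \<open>R\<close> be a localization of an algebra over \<open>A\<close> whose generators have the images
  \<open>X = {x\<^sub>1, \<dots>, x\<^sub>n}\<close> in \<open>R\<close>. Expanding \<open>1 = \<Prod>\<^sub>i (x\<^sub>i + (1 - x\<^sub>i))\<close> shows that the \<open>2\<^sup>n\<close> products \<open>f\<close>
  with one factor \<open>x\<^sub>i\<close> or \<open>1 - x\<^sub>i\<close> for each \<open>i\<close> generate the unit ideal (\<open>span_cover_elements\<close>).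
  If \<open>f \<noteq> 0\<close>, then for each \<open>i\<close> either \<open>x\<^sub>i\<close> or \<open>1 - x\<^sub>i\<close> is a unit of \<open>R[1/f]\<close>, so every \<open>x\<^sub>i\<close> lies in
  the ring \<open>E\<close> of \<open>R[1/f]\<close>; so does the image of \<open>A\<close>, whose nonzero elements are units or integral
  over \<open>\<int>\<close>, and so do the inverses of all denominators. Hence \<open>R[1/f]\<close> is Egyptian.\<close>

section \<open>Subrings\<close>

lemma subring_of_zero: "subring_of D \<Longrightarrow> 0 \<in> D"
  by (metis diff_self subring_of_def)

lemma subring_of_uminus: "subring_of D \<Longrightarrow> x \<in> D \<Longrightarrow> - x \<in> D"
  by (metis diff_0 subring_of_def subring_of_zero)

lemma subring_of_add: "subring_of D \<Longrightarrow> x \<in> D \<Longrightarrow> y \<in> D \<Longrightarrow> x + y \<in> D"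
  by (metis diff_minus_eq_add subring_of_def subring_of_uminus)

lemma subring_of_mult: "subring_of D \<Longrightarrow> x \<in> D \<Longrightarrow> y \<in> D \<Longrightarrow> x * y \<in> D"
  by (simp add: subring_of_def)

lemma subring_of_one: "subring_of D \<Longrightarrow> 1 \<in> D"
  by (simp add: subring_of_def)

lemma subring_of_power: "subring_of D \<Longrightarrow> x \<in> D \<Longrightarrow> x ^ n \<in> D"
  by (induction n) (auto intro: subring_of_one subring_of_mult)

lemma subring_of_of_nat: "subring_of D \<Longrightarrow> of_nat n \<in> D"
  by (induction n) (auto intro: subring_of_one subring_of_zero subring_of_add)

lemma subring_of_of_int: "subring_of D \<Longrightarrow> of_int n \<in> D"
  by (cases n rule: int_cases2) (auto intro: subring_of_of_nat subring_of_uminus)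

lemma subring_of_sum: "subring_of D \<Longrightarrow> (\<And>i. i \<in> I \<Longrightarrow> f i \<in> D) \<Longrightarrow> sum f I \<in> D"
  by (induction I rule: infinite_finite_induct) (auto intro: subring_of_zero subring_of_add)

lemma subring_of_vimage:
  assumes "comm_ring_hom h" "subring_of D"
  shows "subring_of (h -` D)"
proof -
  interpret comm_ring_hom h by fact
  show ?thesis using assms(2) by (auto simp: subring_of_def hom_minus hom_mult)
qed

section \<open>One as a sum of distinct unit fractions with large denominators\<close>

text \<open>The Fibonacci--Sylvester algorithm: subtracting the largest unit fraction \<open>1 / n \<le> a / b\<close>
  decreases the numerator, and the remainder is smaller than \<open>1 / n\<close>, so that all later
  denominators exceed \<open>n\<close>.\<close>

lemma greedy_unit_fractions:
  fixes a b N :: nat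
  assumes "0 < b" "0 < N" "a * N < b"
  shows "\<exists>T. finite T \<and> T \<subseteq> {N<..} \<and> (\<Sum>n\<in>T. 1 / real n) = real a / real b"
  using assms
proof (induction a arbitrary: b N rule: less_induct)
  case (less a)
  show ?case
  proof (cases "a = 0")
    case True
    then show ?thesis by (intro exI[of _ "{}"]) auto
  next
    case False
    define n where "n = (LEAST n. b \<le> a * n)"
    have n: "b \<le> a * n"
      unfolding n_def by (rule LeastI[of _ b]) (use False in simp)
    have below: "a * m < b" if "m < n" for m
      using not_less_Least that unfolding n_def by (metis not_le_imp_less)
    have "N < n"
      by (rule ccontr) (use n less.prems mult_le_mono2[of n N a] in linarith)
    have "a * (n - 1) < b" using below \<open>N < n\<close> by simp
    then have small: "a * n < a + b" using \<open>N < n\<close> by (cases n) auto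
    have "a \<le> a * N" using \<open>0 < N\<close> by simp
    then have "a * n - b < b" using small less.prems by linarith
    then have "(a * n - b) * n < b * n" using \<open>N < n\<close> by simp
    moreover have "a * n - b < a" using small n by linarith
    ultimately obtain T where T: "finite T" "T \<subseteq> {n<..}"
      "(\<Sum>n\<in>T. 1 / real n) = real (a * n - b) / real (b * n)"
      using less.IH[of "a * n - b" "b * n" n] less.prems \<open>N < n\<close> by auto
    have "n \<notin> T" using T(2) by auto
    then have "(\<Sum>n\<in>insert n T. 1 / real n) = 1 / real n + real (a * n - b) / real (b * n)"
      using T by simp
    also have "\<dots> = real a / real b"
      using n less.prems \<open>N < n\<close> by (simp add: field_simps)
    finally show ?thesis
      using T \<open>N < n\<close> by (intro exI[of _ "insert n T"]) auto
  qed
qed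

text \<open>The numerator is a natural number given by the same formula in every field. This is what lets
  an identity between unit fractions pass from the reals to any field of characteristic \<open>0\<close>.\<close>

lemma sum_unit_fractions_common_denominator:
  assumes "finite T" "\<And>n. n \<in> T \<Longrightarrow> of_nat n \<noteq> (0 :: 'k::field)"
  shows "(\<Sum>n\<in>T. 1 / of_nat n :: 'k) = of_nat (\<Sum>n\<in>T. \<Prod>(T - {n})) / of_nat (\<Prod>T)"
proof -
  have "1 / of_nat n = of_nat (\<Prod>(T - {n})) / (of_nat (\<Prod>T) :: 'k)" if "n \<in> T" for n
  proof -
    have "\<Prod>T = n * \<Prod>(T - {n})" using prod.remove[OF assms(1) that, of id] by simp
    moreover have "of_nat (\<Prod>(T - {n})) \<noteq> (0 :: 'k)"
      using assms by simp
    ultimately show ?thesis using assms(2)[OF that] by simp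
  qed
  then have "(\<Sum>n\<in>T. 1 / of_nat n :: 'k) = (\<Sum>n\<in>T. of_nat (\<Prod>(T - {n})) / of_nat (\<Prod>T))"
    by (rule sum.cong[OF refl])
  then show ?thesis by (simp only: sum_divide_distrib of_nat_sum)
qed

lemma half_le_harmonic_block:
  assumes "0 < (n :: nat)"
  shows "1 / 2 \<le> (\<Sum>k\<in>{n<..2 * n}. 1 / real k)"
proof -
  have "(\<Sum>k\<in>{n<..2 * n}. 1 / real (2 * n)) \<le> (\<Sum>k\<in>{n<..2 * n}. 1 / real k)"
    using assms by (intro sum_mono) (simp add: field_simps)
  then show ?thesis using assms by simp
qed

text \<open>The harmonic series diverges, so the sum of \<open>1 / (N + 1), 1 / (N + 2), \<dots>\<close> can be stopped at the
  last term \<open>1 / M\<close> for which it does not exceed \<open>1\<close>. The rest is then smaller than \<open>1 / (M + 1)\<close>,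
  and the greedy algorithm writes it with denominators beyond \<open>M + 1\<close>.\<close>

lemma one_as_large_unit_fractions:
  "\<exists>T. finite T \<and> T \<subseteq> {N<..} \<and> (\<Sum>n\<in>T. 1 / real n) = 1"
proof (cases "N = 0")
  case True
  then show ?thesis by (intro exI[of _ "{1}"]) auto
next
  case False
  define H where "H m = (\<Sum>n\<in>{N<..m}. 1 / real n)" for m
  have H_Suc: "H (Suc m) = H m + 1 / real (Suc m)" if "N \<le> m" for m
  proof -
    have "{N<..Suc m} = insert (Suc m) {N<..m}" using that by auto
    then show ?thesis by (simp add: H_def)
  qed
  \<comment> \<open>Two consecutive dyadic blocks contribute at least one half each, which already reaches \<open>1\<close>.\<close>
  have "{N<..4 * N} = {N<..2 * N} \<union> {2 * N<..2 * (2 * N)}" using False by auto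
  then have "H (4 * N) = (\<Sum>k\<in>{N<..2 * N}. 1 / real k) + (\<Sum>k\<in>{2 * N<..2 * (2 * N)}. 1 / real k)"
    unfolding H_def by (simp only:) (rule sum.union_disjoint, auto)
  then have "1 \<le> H (4 * N)"
    using half_le_harmonic_block[of N] half_le_harmonic_block[of "2 * N"] False by linarith
  then have "1 < H (Suc (4 * N))" using H_Suc[of "4 * N"] by (simp add: less_le_trans[of 1 "1 + 1 / (1 + 4 * real N)"])
  then obtain m where m: "1 < H m" "\<And>k. k < m \<Longrightarrow> \<not> 1 < H k"
    using exists_least_iff[of "\<lambda>m. 1 < H m"] by blast
  have "N < m"
    by (rule ccontr) (use m(1) in \<open>simp add: H_def\<close>)
  then obtain M where M: "m = Suc M" "N \<le> M" by (cases m) auto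
  have HM: "H M \<le> 1" "1 < H M + 1 / real (Suc M)"
    using m(2)[of M] m(1) H_Suc[OF M(2)] M(1) by auto
  define b c where "b = \<Prod>{N<..M}" and "c = (\<Sum>n\<in>{N<..M}. \<Prod>({N<..M} - {n}))"
  have "0 < b" unfolding b_def by (rule prod_pos) auto
  have HM_eq: "H M = real c / real b"
    unfolding H_def b_def c_def by (rule sum_unit_fractions_common_denominator) auto
  then have "c \<le> b" using HM(1) \<open>0 < b\<close> by simp
  then have rest: "1 - H M = real (b - c) / real b"
    using HM_eq \<open>0 < b\<close> by (simp add: diff_divide_distrib)
  have "real (b - c) / real b < 1 / real (Suc M)"
    using HM(2) rest by linarith
  then have "real ((b - c) * Suc M) < real b"
    using \<open>0 < b\<close> by (simp add: field_simps)
  then have "(b - c) * Suc M < b" by (simp only: of_nat_less_iff)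
  then obtain T where T: "finite T" "T \<subseteq> {Suc M<..}" "(\<Sum>n\<in>T. 1 / real n) = 1 - H M"
    using greedy_unit_fractions[of b "Suc M" "b - c"] \<open>0 < b\<close> rest by auto
  have "{N<..M} \<inter> T = {}" using T(2) by auto
  then have "(\<Sum>n\<in>{N<..M} \<union> T. 1 / real n) = H M + (1 - H M)"
    unfolding H_def T(3)[unfolded H_def, symmetric]
    using T(1) by (intro sum.union_disjoint) auto
  then show ?thesis
    using T M by (intro exI[of _ "{N<..M} \<union> T"]) auto
qed

lemma one_as_large_unit_fractions_char_0:
  assumes "\<And>n. 0 < n \<Longrightarrow> of_nat n \<noteq> (0 :: 'k::field)"
  shows "\<exists>T. finite T \<and> T \<subseteq> {N<..} \<and> (\<Sum>n\<in>T. 1 / of_nat n) = (1 :: 'k)"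
proof -
  obtain T where T: "finite T" "T \<subseteq> {N<..}" "(\<Sum>n\<in>T. 1 / real n) = 1"
    using one_as_large_unit_fractions by blast
  have pos: "0 < n" if "n \<in> T" for n using that T(2) by (auto intro: gr0I)
  then have "0 < \<Prod>T" by (rule prod_pos)
  have "(\<Sum>n\<in>T. 1 / real n) = real (\<Sum>n\<in>T. \<Prod>(T - {n})) / real (\<Prod>T)"
    using T(1) pos by (intro sum_unit_fractions_common_denominator) auto
  then have "real (\<Sum>n\<in>T. \<Prod>(T - {n})) = real (\<Prod>T)"
    using T(3) \<open>0 < \<Prod>T\<close> by (simp add: field_simps)
  then have eq: "(\<Sum>n\<in>T. \<Prod>(T - {n})) = \<Prod>T" by (simp only: of_nat_eq_iff)
  have "(\<Sum>n\<in>T. 1 / of_nat n :: 'k) = of_nat (\<Sum>n\<in>T. \<Prod>(T - {n})) / of_nat (\<Prod>T)"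
    using T(1) pos assms by (intro sum_unit_fractions_common_denominator) auto
  also have "\<dots> = 1" unfolding eq using assms[OF \<open>0 < \<Prod>T\<close>] by simp
  finally show ?thesis using T by blast
qed

section \<open>Making denominators distinct\<close>

text \<open>In characteristic \<open>0\<close>, a new summand \<open>1 / d\<close> is spread out as a sum of \<open>1 / (d * n)\<close> over
  distinct positive integers \<open>n\<close> of total reciprocal \<open>1\<close>. Only finitely many \<open>n\<close> give a
  denominator already in \<open>S\<close>, so taking all \<open>n\<close> large avoids collisions.\<close>

lemma add_unit_fraction_distinct_char_0:
  fixes D :: "'k::field set"
  assumes D: "subring_of D" and char: "\<And>n. 0 < n \<Longrightarrow> of_nat n \<noteq> (0 :: 'k)"
    and S: "finite S" "S \<subseteq> D - {0}" and d: "d \<in> D - {0}"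
  shows "\<exists>S'. finite S' \<and> S' \<subseteq> D - {0} \<and> 1 / d + (\<Sum>s\<in>S. 1 / s) = (\<Sum>s\<in>S'. 1 / s)"
proof -
  have inj: "inj (\<lambda>n. d * of_nat n)"
  proof (rule injI)
    fix m n :: nat
    have *: "m = n" if "m \<le> n" "of_nat m = (of_nat n :: 'k)" for m n :: nat
      using char[of "n - m"] that by (cases "m = n") auto
    assume "d * of_nat m = d * of_nat n"
    then have "of_nat m = (of_nat n :: 'k)" using d by simp
    then show "m = n" using *[of m n] *[of n m] by (cases "m \<le> n") auto
  qed
  have "finite ((\<lambda>n. d * of_nat n) -` S)" using S(1) inj by (rule finite_vimageI)
  then obtain N where N: "\<And>n. d * of_nat n \<in> S \<Longrightarrow> n \<le> N"
    unfolding finite_nat_set_iff_bounded_le by auto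
  obtain T where T: "finite T" "T \<subseteq> {N<..}" "(\<Sum>n\<in>T. 1 / of_nat n) = (1 :: 'k)"
    using one_as_large_unit_fractions_char_0[OF char] by blast
  let ?T = "(\<lambda>n. d * of_nat n) ` T"
  have "1 / d = 1 / d * (\<Sum>n\<in>T. 1 / of_nat n)" by (simp add: T(3))
  also have "\<dots> = (\<Sum>t\<in>?T. 1 / t)"
    using inj by (subst sum.reindex) (auto simp: sum_distrib_left intro: inj_on_subset)
  finally have "1 / d = (\<Sum>t\<in>?T. 1 / t)" .
  moreover have "?T \<inter> S = {}" using N T(2) by fastforce
  ultimately have "1 / d + (\<Sum>s\<in>S. 1 / s) = (\<Sum>s\<in>?T \<union> S. 1 / s)"
    using T(1) S(1) by (simp add: sum.union_disjoint)
  moreover have "?T \<subseteq> D - {0}"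
    using d T(2) char D by (auto intro!: subring_of_mult subring_of_of_nat)
  ultimately show ?thesis using S T(1) by (intro exI[of _ "?T \<union> S"]) auto
qed

text \<open>If \<open>p = 2 * q + 1\<close> vanishes in the field, then \<open>q + 1\<close> is one half; even \<open>p\<close> can be
  halved unless \<open>2 = 0\<close>.\<close>

lemma two_eq_0_or_half_of_nat:
  assumes "0 < p" "of_nat p = (0 :: 'k::field)"
  shows "(2 :: 'k) = 0 \<or> (\<exists>k. 2 * of_nat k = (1 :: 'k))"
  using assms
proof (induction p rule: less_induct)
  case (less p)
  show ?case
  proof (cases "even p")
    case True
    then obtain q where q: "p = 2 * q" by (elim evenE)
    then have "(2 :: 'k) = 0 \<or> of_nat q = (0 :: 'k)" using less.prems by simp
    then show ?thesis using less.IH[of q] less.prems q by auto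
  next
    case False
    then obtain q where "p = 2 * q + 1" by (elim oddE)
    then have "2 * of_nat (q + 1) = (1 :: 'k)" using less.prems by (simp add: algebra_simps)
    then show ?thesis by blast
  qed
qed

text \<open>In positive characteristic, two equal summands \<open>1 / d\<close> either cancel or merge into the single
  unit fraction \<open>2 / d = 1 / (d * k)\<close>, where the integer \<open>k\<close> represents one half. A merged fraction
  may collide again, but with a smaller set of remaining denominators.\<close>

lemma add_unit_fraction_distinct_char_p:
  fixes D :: "'k::field set"
  assumes D: "subring_of D" and p: "0 < p" "of_nat p = (0 :: 'k)"
    and "finite S" "S \<subseteq> D - {0}" "d \<in> D - {0}"
  shows "\<exists>S'. finite S' \<and> S' \<subseteq> D - {0} \<and> 1 / d + (\<Sum>s\<in>S. 1 / s) = (\<Sum>s\<in>S'. 1 / s)"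
  using assms(4-)
proof (induction "card S" arbitrary: S d rule: less_induct)
  case less
  show ?case
  proof (cases "d \<in> S")
    case False
    then show ?thesis using less.prems by (intro exI[of _ "insert d S"]) auto
  next
    case True
    then have sum: "1 / d + (\<Sum>s\<in>S. 1 / s) = 2 / d + (\<Sum>s\<in>S - {d}. 1 / s)"
      using less.prems by (simp add: sum.remove)
    from two_eq_0_or_half_of_nat[OF p] show ?thesis
    proof (elim disjE exE)
      assume "(2 :: 'k) = 0"
      then show ?thesis using sum less.prems by (intro exI[of _ "S - {d}"]) auto
    next
      fix k assume k: "2 * of_nat k = (1 :: 'k)"
      then have "of_nat k \<noteq> (0 :: 'k)" by auto
      then have "d * of_nat k \<in> D - {0}" "2 / d = 1 / (d * of_nat k)"
        using less.prems D k by (auto intro!: subring_of_mult subring_of_of_nat simp: field_simps)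
      moreover have "card (S - {d}) < card S"
        using True less.prems by (intro card_Diff1_less)
      ultimately show ?thesis
        using less.hyps[of "S - {d}" "d * of_nat k"] sum less.prems by auto
    qed
  qed
qed

section \<open>The ring of sums of unit fractions\<close>

text \<open>Unlike in \<open>egyptian_element\<close>, the denominators may repeat and the empty sum is allowed; this is
  what makes the set a ring. It is known as the reciprocal complement of \<open>D\<close>.\<close>

inductive_set unit_fraction_sums :: "'k::field set \<Rightarrow> 'k set" for D where
  zero: "0 \<in> unit_fraction_sums D"
| add: "d \<in> D - {0} \<Longrightarrow> x \<in> unit_fraction_sums D \<Longrightarrow> 1 / d + x \<in> unit_fraction_sums D"

lemma inverse_in_unit_fraction_sums: "d \<in> D \<Longrightarrow> d \<noteq> 0 \<Longrightarrow> 1 / d \<in> unit_fraction_sums D"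
  using unit_fraction_sums.add[OF _ unit_fraction_sums.zero, of d D] by simp

lemma unit_in_unit_fraction_sums: "1 / u \<in> D \<Longrightarrow> u \<noteq> 0 \<Longrightarrow> u \<in> unit_fraction_sums D"
  using inverse_in_unit_fraction_sums[of "1 / u" D] by simp

lemma subring_of_unit_fraction_sums:
  fixes D :: "'k::field set"
  assumes D: "subring_of D"
  shows "subring_of (unit_fraction_sums D)"
proof -
  let ?E = "unit_fraction_sums D"
  have plus: "x + y \<in> ?E" if "x \<in> ?E" "y \<in> ?E" for x y
    using that by (induction rule: unit_fraction_sums.induct)
      (auto intro: unit_fraction_sums.add simp: add.assoc)
  have minus: "- x \<in> ?E" if "x \<in> ?E" for x
    using that
  proof induction
    case (add d x)
    then have "1 / (- d) + - x \<in> ?E"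
      using subring_of_uminus[OF D] by (intro unit_fraction_sums.add) auto
    then show ?case by simp
  qed (simp add: unit_fraction_sums.zero)
  have scale: "1 / d * x \<in> ?E" if "x \<in> ?E" "d \<in> D - {0}" for d x
    using that
  proof induction
    case (add e x)
    then have "1 / (d * e) + 1 / d * x \<in> ?E"
      using subring_of_mult[OF D] by (intro unit_fraction_sums.add) auto
    then show ?case by (simp add: distrib_left)
  qed (simp add: unit_fraction_sums.zero)
  have mult: "x * y \<in> ?E" if "x \<in> ?E" "y \<in> ?E" for x y
    using that
  proof induction
    case (add d x)
    have "1 / d * y + x * y \<in> ?E"
      using plus[OF scale[OF \<open>y \<in> ?E\<close> add.hyps(1)] add.IH[OF \<open>y \<in> ?E\<close>]] .
    then show ?case by (simp add: distrib_right)
  qed (simp add: unit_fraction_sums.zero)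
  have "1 \<in> ?E" using inverse_in_unit_fraction_sums[of 1 D] subring_of_one[OF D] by simp
  moreover have "x - y \<in> ?E" if "x \<in> ?E" "y \<in> ?E" for x y
    using plus[OF that(1) minus[OF that(2)]] by simp
  ultimately show ?thesis using mult by (auto simp: subring_of_def)
qed

text \<open>Adding the summands one at a time, the denominators can be kept distinct at each step, in
  characteristic \<open>0\<close> by spreading and in positive characteristic by merging. A nonzero sum
  is not the empty one.\<close>

lemma egyptian_element_if_unit_fraction_sum:
  fixes D :: "'k::field set"
  assumes D: "subring_of D" and x: "x \<in> unit_fraction_sums D" "x \<noteq> 0"
  shows "egyptian_element D x"
proof -
  have distinct: "\<exists>S'. finite S' \<and> S' \<subseteq> D - {0} \<and> 1 / d + (\<Sum>s\<in>S. 1 / s) = (\<Sum>s\<in>S'. 1 / s)"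
    if "finite S" "S \<subseteq> D - {0}" "d \<in> D - {0}" for S d
    using add_unit_fraction_distinct_char_0[OF D _ that]
      add_unit_fraction_distinct_char_p[OF D _ _ that] by blast
  have "\<exists>S. finite S \<and> S \<subseteq> D - {0} \<and> x = (\<Sum>s\<in>S. 1 / s)"
    using x(1)
  proof induction
    case zero
    show ?case by (intro exI[of _ "{}"]) auto
  next
    case (add d x)
    then show ?case using distinct by metis
  qed
  then show ?thesis using x(2) unfolding egyptian_element_def by force
qed

text \<open>An equation \<open>x\<^sup>n\<^sup>+\<^sup>1 = - (c\<^sub>0 + \<dots> + c\<^sub>n x\<^sup>n)\<close> with integers \<open>c\<^sub>i\<close>, divided by \<open>x\<^sup>n\<close>, expresses \<open>x\<close> as
  a polynomial in the reciprocal \<open>1 / x\<close> with integer coefficients.\<close>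

lemma integral_in_unit_fraction_sums:
  fixes D :: "'k::field set"
  assumes D: "subring_of D" and x: "x \<in> D"
    and p: "lead_coeff p = 1" "poly (map_poly of_int p) x = 0"
  shows "x \<in> unit_fraction_sums D"
proof (cases "x = 0")
  case True
  then show ?thesis by (simp add: unit_fraction_sums.zero)
next
  case False
  let ?E = "unit_fraction_sums D"
  note E = subring_of_unit_fraction_sums[OF D]
  have deg: "degree (map_poly of_int p :: 'k poly) = degree p"
    by (rule map_poly_degree_eq) (simp add: p(1))
  have "(\<Sum>i\<le>degree p. of_int (coeff p i) * x ^ i) = 0"
    using p(2) by (simp add: poly_altdef deg coeff_map_poly)
  moreover have "degree p \<noteq> 0"
  proof
    assume "degree p = 0"
    then have "p = 1" using p(1) by (metis degree_0_id one_pCons)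
    then show False using p(2) by simp
  qed
  then obtain n where n: "degree p = Suc n" by (cases "degree p") auto
  ultimately have "x ^ n * x = - (\<Sum>i\<le>n. of_int (coeff p i) * x ^ i)"
    using p(1) by (simp add: eq_neg_iff_add_eq_0 algebra_simps)
  also have "\<dots> = x ^ n * - (\<Sum>i\<le>n. of_int (coeff p i) * (1 / x) ^ (n - i))"
    using False by (auto simp: sum_distrib_left power_diff power_one_over intro!: sum.cong)
  finally have "x = - (\<Sum>i\<le>n. of_int (coeff p i) * (1 / x) ^ (n - i))"
    using False by (simp only: mult_cancel_left power_eq_0_iff) simp
  moreover have "\<dots> \<in> ?E"
    using x False
    by (intro subring_of_uminus subring_of_sum subring_of_mult subring_of_of_int subring_of_power
        inverse_in_unit_fraction_sums E)
  ultimately show ?thesis by simp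
qed

section \<open>A cover of the spectrum\<close>

lemma module_times: "Modules.module ((*) :: 'r::comm_ring_1 \<Rightarrow> 'r \<Rightarrow> 'r)"
  by unfold_locales (simp_all add: algebra_simps)

text \<open>The term indexed by \<open>A\<close> in the expansion of the product of all \<open>x + (1 - x)\<close> with \<open>x \<in> X\<close>.\<close>

definition cover_element :: "'r::comm_ring_1 set \<Rightarrow> 'r set \<Rightarrow> 'r" where
  "cover_element X A = (\<Prod>x\<in>A. x) * (\<Prod>x\<in>X - A. 1 - x)"

lemma span_cover_elements:
  fixes X :: "'r::comm_ring_1 set"
  assumes "finite X"
  shows "module.span (*) (cover_element X ` Pow X - {0}) = UNIV"
proof -
  interpret Modules.module "(*) :: 'r \<Rightarrow> 'r \<Rightarrow> 'r" by (rule module_times)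
  let ?I = "span (cover_element X ` Pow X - {0})"
  have "(\<Sum>A\<in>Pow X. cover_element X A) = 1"
    using prod_add[OF assms, of "\<lambda>x. x" "\<lambda>x. 1 - x"] by (simp add: cover_element_def)
  moreover have "cover_element X A \<in> ?I" if "A \<in> Pow X" for A
    using that span_zero span_base by (cases "cover_element X A = 0") auto
  then have "(\<Sum>A\<in>Pow X. cover_element X A) \<in> ?I" by (rule span_sum)
  ultimately have "1 \<in> ?I" by simp
  then have "r \<in> ?I" for r using span_scale[of 1 _ r] by simp
  then show ?thesis by blast
qed

lemma dvd_cover_element:
  assumes "finite X" "A \<subseteq> X" "x \<in> X"
  shows "x dvd cover_element X A \<or> 1 - x dvd cover_element X A"
proof (cases "x \<in> A")
  case True
  then show ?thesis
    using assms finite_subset unfolding cover_element_def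
    by (intro disjI1 dvd_mult2 dvd_prodI) auto
next
  case False
  then show ?thesis
    using assms unfolding cover_element_def
    by (intro disjI2 dvd_mult dvd_prodI[of _ x "\<lambda>x. 1 - x"]) auto
qed

section \<open>Localizations of algebras of finite type\<close>

lemma subring_of_localization_away:
  assumes "f \<noteq> 0"
  shows "subring_of (localization_away f)"
proof -
  have "Fract a (f ^ m) - Fract b (f ^ n) \<in> localization_away f"
    and "Fract a (f ^ m) * Fract b (f ^ n) \<in> localization_away f" for a b m n
    using assms by (auto simp: localization_away_def power_add [symmetric])
  moreover have "1 \<in> localization_away f"
    unfolding localization_away_def One_fract_def by (force intro: exI[of _ 0])
  ultimately show ?thesis
    unfolding subring_of_def by (auto simp: localization_away_def)
qed

lemma to_fract_in_localization_away: "to_fract r \<in> localization_away f"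
  unfolding localization_away_def to_fract_def by (force intro: exI[of _ 0])

lemma inverse_divisor_in_localization_away:
  assumes "g dvd f" "f \<noteq> 0"
  shows "1 / to_fract g \<in> localization_away f"
proof -
  obtain h where h: "f = g * h" using assms by (elim dvdE)
  then have "1 / to_fract g = Fract h (f ^ 1)"
    using assms by (simp add: Fract_conv_to_fract)
  then show ?thesis unfolding localization_away_def by blast
qed

text \<open>The elements of the algebra whose images lie in the ring \<open>E\<close> of sums of unit fractions of
  \<open>R[1/f]\<close> form a subring; it contains the generators, hence everything. Every element of \<open>R[1/f]\<close>
  is obtained from such an image by dividing by nonzero elements of \<open>R\<close>, and their reciprocals are
  in \<open>E\<close>. The condition on \<open>G\<close> makes each generator \<open>x\<close>, or else \<open>1 - x\<close>, a unit of \<open>R[1/f]\<close>.\<close>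

lemma egyptian_localization_away:
  fixes f :: "'r::idom" and \<iota> :: "'b::comm_ring_1 \<Rightarrow> 'r"
  assumes f: "f \<noteq> 0"
    and \<iota>: "is_localization M \<iota>"
    and gen: "subring_of hull (B \<union> G) = UNIV"
    and B: "\<And>b. b \<in> B \<Longrightarrow> to_fract (\<iota> b) \<in> unit_fraction_sums (localization_away f)"
    and G: "\<And>g. g \<in> G \<Longrightarrow> \<iota> g dvd f \<or> 1 - \<iota> g dvd f"
  shows "egyptian (localization_away f)"
proof -
  let ?D = "localization_away f"
  let ?E = "unit_fraction_sums ?D"
  interpret \<iota>: comm_ring_hom \<iota> using \<iota> by (simp add: is_localization_def)
  note D = subring_of_localization_away[OF f]
  note E = subring_of_unit_fraction_sums[OF D]
  have unit: "to_fract g \<in> ?E" if "g dvd f" for g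
    using that f by (intro unit_in_unit_fraction_sums inverse_divisor_in_localization_away) auto
  have "to_fract (\<iota> g) \<in> ?E" if "g \<in> G" for g
    using G[OF that]
  proof
    assume "1 - \<iota> g dvd f"
    then have "1 - to_fract (1 - \<iota> g) \<in> ?E"
      using unit E subring_of_one[OF E] by (metis subring_of_def)
    then show ?thesis by simp
  qed (rule unit)
  moreover have "comm_ring_hom (to_fract \<circ> \<iota>)"
    by unfold_locales (simp_all add: \<iota>.hom_add \<iota>.hom_mult)
  ultimately have "subring_of hull (B \<union> G) \<subseteq> (to_fract \<circ> \<iota>) -` ?E"
    using B E by (intro hull_minimal subring_of_vimage) auto
  then have image: "to_fract (\<iota> b) \<in> ?E" for b unfolding gen by auto
  have R: "to_fract r \<in> ?E" for r
  proof -
    obtain b m where m: "m \<in> M" "r * \<iota> m = \<iota> b"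
      using \<iota> unfolding is_localization_def by meson
    have "\<iota> m dvd 1" using \<iota> m(1) by (simp add: is_localization_def)
    then have nz: "\<iota> m \<noteq> 0" by auto
    then have "to_fract r = to_fract (\<iota> b) * (1 / to_fract (\<iota> m))"
      by (simp add: m(2) [symmetric])
    also have "\<dots> \<in> ?E"
      using nz by (intro subring_of_mult[OF E] image inverse_in_unit_fraction_sums
          to_fract_in_localization_away) auto
    finally show ?thesis .
  qed
  have "x \<in> ?E" if x: "x \<in> ?D" for x
  proof -
    obtain a n where "x = Fract a (f ^ n)" using x by (auto simp: localization_away_def)
    then have "x = to_fract a * (1 / to_fract (f ^ n))" by (simp add: Fract_conv_to_fract)
    also have "\<dots> \<in> ?E"
      using f by (intro subring_of_mult[OF E] R inverse_in_unit_fraction_sums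
          to_fract_in_localization_away) auto
    finally show ?thesis .
  qed
  then show ?thesis
    using D egyptian_element_if_unit_fraction_sum[OF D] by (auto simp: egyptian_def)
qed

text \<open>The nonzero elements of \<open>A\<close> are units or integral over \<open>\<int>\<close>, and homomorphisms preserve either
  property.\<close>

lemma base_ring_in_unit_fraction_sums:
  fixes \<psi> :: "'a::idom \<Rightarrow> 'k::field"
  assumes A: "is_field TYPE('a) \<or> integral_extension_of_int TYPE('a)"
    and \<psi>: "comm_ring_hom \<psi>"
    and D: "subring_of D" "range \<psi> \<subseteq> D"
  shows "\<psi> a \<in> unit_fraction_sums D"
  using A
proof
  interpret comm_ring_hom \<psi> by fact
  {
    assume field: "is_field TYPE('a)"
    show ?thesis
    proof (cases "a = 0")
      case True
      then show ?thesis by (simp add: unit_fraction_sums.zero)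
    next
      case False
      then obtain b where "a * b = 1" using field by (auto simp: is_field_def)
      then have "\<psi> a * \<psi> b = 1" by (metis hom_mult hom_one)
      moreover from this have "\<psi> a \<noteq> 0" by auto
      ultimately have "1 / \<psi> a = \<psi> b" "\<psi> a \<noteq> 0" by (simp_all add: field_simps)
      then show ?thesis using D(2) by (intro unit_in_unit_fraction_sums) auto
    qed
  next
    assume "integral_extension_of_int TYPE('a)"
    then obtain p :: "int poly" where p: "lead_coeff p = 1" "poly (map_poly of_int p) a = 0"
      unfolding integral_extension_of_int_def by blast
    have "map_poly \<psi> (map_poly of_int p) = map_poly of_int p"
      by (simp add: map_poly_map_poly o_def hom_of_int)
    then have "poly (map_poly of_int p) (\<psi> a) = \<psi> (poly (map_poly of_int p) a)"
      by (metis poly_map_poly)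
    then have "poly (map_poly of_int p) (\<psi> a) = 0" using p(2) by simp
    then show ?thesis using integral_in_unit_fraction_sums[OF D(1) _ p(1)] D(2) by auto
  }
qed

theorem corollary3p11:
  fixes \<phi> :: "'a::idom \<Rightarrow> 'r::idom"
  assumes "is_field TYPE('a) \<or> integral_extension_of_int TYPE('a)"
    and "essentially_finite_type TYPE('b::comm_ring_1) \<phi>"
  shows "locally_egyptian TYPE('r)"
proof -
  obtain \<alpha> :: "'a \<Rightarrow> 'b" and M \<iota> G where
    \<alpha>: "comm_ring_hom \<alpha>" and G: "finite G" "subring_of hull (range \<alpha> \<union> G) = UNIV"
    and \<iota>: "is_localization M \<iota>" and \<phi>: "\<phi> = \<iota> \<circ> \<alpha>"
    using assms(2) unfolding essentially_finite_type_def finitely_generated_algebra_def by blast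
  interpret \<alpha>: comm_ring_hom \<alpha> by fact
  interpret \<iota>: comm_ring_hom \<iota> using \<iota> by (simp add: is_localization_def)
  have hom: "comm_ring_hom (to_fract \<circ> \<phi>)"
    unfolding \<phi>
    by unfold_locales (simp_all add: \<iota>.hom_add \<iota>.hom_mult \<alpha>.hom_add \<alpha>.hom_mult)
  define X where "X = \<iota> ` G"
  have X: "finite X" using G(1) by (simp add: X_def)
  have "egyptian (localization_away f)" if f: "f \<in> cover_element X ` Pow X - {0}" for f
  proof (rule egyptian_localization_away[OF _ \<iota> G(2)])
    show "f \<noteq> 0" using f by simp
    show "to_fract (\<iota> b) \<in> unit_fraction_sums (localization_away f)" if "b \<in> range \<alpha>" for b
    proof -
      obtain a where "b = \<alpha> a" using \<open>b \<in> range \<alpha>\<close> by blast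
      moreover have "range (to_fract \<circ> \<phi>) \<subseteq> localization_away f"
        using to_fract_in_localization_away by auto
      ultimately show ?thesis
        using base_ring_in_unit_fraction_sums[OF assms(1) hom
            subring_of_localization_away[OF \<open>f \<noteq> 0\<close>], of a] \<phi> by simp
    qed
    show "\<iota> g dvd f \<or> 1 - \<iota> g dvd f" if "g \<in> G" for g
      using f dvd_cover_element[OF X, of _ "\<iota> g"] that by (auto simp: X_def)
  qed
  then show ?thesis
    unfolding locally_egyptian_def
    using span_cover_elements[OF X] X
    by (intro exI[of _ "cover_element X ` Pow X - {0}"]) auto
qed

end
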